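(* Let $\ell^*=\min\{f(x)\mid x\in\Delta^c\}$ and $u^*=\max\{f(x)\mid x\in\Delta\}$, and assume $\ell^*<u^*$. Let $\epsilon>0$, and put $\rho^*=u^*$ and $\sigma^*=u^*-\ell^*+\epsilon$. Then: (1) there is no $x\in\Delta$ with $f(x)>\rho^*$; (2) for every $x\in\Delta^c$, $f(x)+\sigma^*\lVert Ax-b\rVert^2>\rho^*$.
   Context: Let $\hat F\in\mathbb{R}^{n\times n}$ be symmetric, $\hat c\in\mathbb{R}^n$, $\hat A\in\mathbb{Z}^{m\times n}$, $\hat b\in\mathbb{Z}^m$. With $e$ the all-ones vector, let $F=\frac14\hat F$, $c=\frac12(\hat c+\hat Fe)$, $\alpha=\frac12\hat c^\top e+\frac14e^\top\hat Fe$, $A=\frac12\hat A$, $b=\hat b-\frac12\hat Ae$. Set $f(x)=x^\top Fx+c^\top x+\alpha$, $\Delta=\{x\in\{-1,1\}^n\mid Ax=b\}$ and $\Delta^c=\{x\in\{-1,1\}^n\mid Ax\neq b\}$. $\lVert\cdot\rVert$ is the Euclidean norm. $\Delta$ and $\Delta^c$ are assumed nonempty, so that $\ell^*$ and $u^*$ are real numbers. *)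

theory Defs
  imports "HOL-Analysis.Analysis"
begin

text \<open>
  The data of a binary problem in a variable \<open>y \<in> {0,1}\<^sup>n\<close> are rewritten for
  \<open>x \<in> {-1,1}\<^sup>n\<close> via \<open>y = (x + e) / 2\<close>. The all-ones vector \<open>e\<close> is the
  library constant \<open>1 :: real ^ 'n\<close>.
\<close>

definition F_mat :: "real ^ 'n ^ 'n \<Rightarrow> real ^ 'n ^ 'n" where
  "F_mat Fh = (1/4) *\<^sub>R Fh"

definition c_vec :: "real ^ 'n ^ 'n \<Rightarrow> real ^ 'n \<Rightarrow> real ^ 'n" where
  "c_vec Fh ch = (1/2) *\<^sub>R (ch + Fh *v 1)"

definition alpha :: "real ^ 'n ^ 'n \<Rightarrow> real ^ 'n \<Rightarrow> real" where
  "alpha Fh ch = (1/2) * (ch \<bullet> 1) + (1/4) * (1 \<bullet> (Fh *v 1))"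

definition A_mat :: "int ^ 'n ^ 'm \<Rightarrow> real ^ 'n ^ 'm" where
  "A_mat Ah = (1/2) *\<^sub>R map_matrix real_of_int Ah"

definition b_vec :: "int ^ 'n ^ 'm \<Rightarrow> int ^ 'm \<Rightarrow> real ^ 'm" where
  "b_vec Ah bh = (\<chi> i. real_of_int (bh $ i)) - (1/2) *\<^sub>R (map_matrix real_of_int Ah *v 1)"

definition objective :: "real ^ 'n ^ 'n \<Rightarrow> real ^ 'n \<Rightarrow> real ^ 'n \<Rightarrow> real" where
  "objective Fh ch x = x \<bullet> (F_mat Fh *v x) + c_vec Fh ch \<bullet> x + alpha Fh ch"

definition sign_vectors :: "(real ^ 'n) set" where
  "sign_vectors = {x. \<forall>i. x $ i \<in> {-1, 1}}"

definition feasible :: "int ^ 'n ^ 'm \<Rightarrow> int ^ 'm \<Rightarrow> (real ^ 'n) set" where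
  "feasible Ah bh = {x \<in> sign_vectors. A_mat Ah *v x = b_vec Ah bh}"

definition infeasible :: "int ^ 'n ^ 'm \<Rightarrow> int ^ 'm \<Rightarrow> (real ^ 'n) set" where
  "infeasible Ah bh = {x \<in> sign_vectors. A_mat Ah *v x \<noteq> b_vec Ah bh}"

text \<open>Both sets are finite, so \<open>Min\<close> and \<open>Max\<close> of the objective over them
  are attained as soon as they are nonempty.\<close>

lemma finite_sign_vectors: "finite (sign_vectors :: (real ^ 'n) set)"
proof -
  have "finite {f :: 'n \<Rightarrow> real. \<forall>i. (i \<in> UNIV \<longrightarrow> f i \<in> {-1, 1}) \<and> (i \<notin> UNIV \<longrightarrow> f i = 0)}"
    by (rule finite_set_of_finite_funs) auto
  then have "finite (vec_lambda ` {f :: 'n \<Rightarrow> real. \<forall>i. f i \<in> {-1, 1}})"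
    by simp
  moreover have "sign_vectors \<subseteq> vec_lambda ` {f :: 'n \<Rightarrow> real. \<forall>i. f i \<in> {-1, 1}}"
  proof
    fix x :: "real ^ 'n"
    assume "x \<in> sign_vectors"
    then have "vec_nth x \<in> {f. \<forall>i. f i \<in> {-1, 1}}"
      by (simp add: sign_vectors_def)
    then have "vec_lambda (vec_nth x) \<in> vec_lambda ` {f :: 'n \<Rightarrow> real. \<forall>i. f i \<in> {-1, 1}}"
      by (rule imageI)
    then show "x \<in> vec_lambda ` {f :: 'n \<Rightarrow> real. \<forall>i. f i \<in> {-1, 1}}"
      by simp
  qed
  ultimately show ?thesis
    by (rule finite_subset[rotated])
qed

lemma finite_feasible: "finite (feasible Ah bh)"
  by (simp add: feasible_def finite_sign_vectors)

lemma finite_infeasible: "finite (infeasible Ah bh)"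
  by (simp add: infeasible_def finite_sign_vectors)

end

theory Submission
  imports Defs
begin

text \<open>
  On sign vectors the residual \<open>A x - b = Ah (x + e) / 2 - bh\<close> is integral, since
  \<open>(x + e) / 2\<close> is a 0/1 vector. Hence a nonzero residual has norm at least 1, and the penalty
  of an infeasible point is at least \<open>\<sigma> > u - l\<close>, which lifts its objective value, at
  least \<open>l\<close>, above \<open>u\<close>.
\<close>

text \<open>The half row sums subtracted in \<open>b_vec\<close> turn \<open>x $ j / 2\<close> into
  \<open>(x $ j + 1) / 2\<close>, which leaves only integer coefficients.\<close>

lemma residual_component:
  "(A_mat Ah *v x - b_vec Ah bh) $ i
    = (\<Sum>j\<in>UNIV. real_of_int (Ah $ i $ j) * ((x $ j + 1) / 2)) - real_of_int (bh $ i)"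
  by (simp add: A_mat_def b_vec_def matrix_vector_mult_def map_matrix_def
      sum_distrib_left sum.distrib[symmetric] field_simps)

lemma residual_component_in_Ints:
  assumes "x \<in> sign_vectors"
  shows "(A_mat Ah *v x - b_vec Ah bh) $ i \<in> \<int>"
proof -
  have "(x $ j + 1) / 2 \<in> \<int>" for j
  proof -
    from assms have "x $ j = -1 \<or> x $ j = 1"
      by (simp add: sign_vectors_def)
    then show ?thesis by auto
  qed
  then show ?thesis
    unfolding residual_component by (intro Ints_diff Ints_sum Ints_mult Ints_of_int)
qed

text \<open>Some component is a nonzero integer, and the norm dominates the absolute value of each
  component.\<close>

lemma norm_Ints_vector_ge_1:
  fixes v :: "real ^ 'n"
  assumes "\<And>i. v $ i \<in> \<int>" and "v \<noteq> 0"
  shows "1 \<le> norm v"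
proof -
  from assms(2) obtain i where "v $ i \<noteq> 0"
    by (auto simp: vec_eq_iff)
  with assms(1)[of i] have "1 \<le> \<bar>v $ i\<bar>"
    by (rule Ints_nonzero_abs_ge1)
  also have "\<dots> \<le> norm v"
    by (rule component_le_norm_cart)
  finally show ?thesis .
qed

theorem lemma6:
  fixes Fh :: "real ^ 'n ^ 'n" and ch :: "real ^ 'n"
    and Ah :: "int ^ 'n ^ 'm" and bh :: "int ^ 'm"
    and l u \<epsilon> \<rho> \<sigma> :: real
  assumes "transpose Fh = Fh"
    and "feasible Ah bh \<noteq> {}"
    and "infeasible Ah bh \<noteq> {}"
    and "l = Min (objective Fh ch ` infeasible Ah bh)"
    and "u = Max (objective Fh ch ` feasible Ah bh)"
    and "l < u"
    and "\<epsilon> > 0"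
    and "\<rho> = u"
    and "\<sigma> = u - l + \<epsilon>"
  shows "(\<not> (\<exists>x \<in> feasible Ah bh. objective Fh ch x > \<rho>)) \<and>
    (\<forall>x \<in> infeasible Ah bh.
       objective Fh ch x + \<sigma> * (norm (A_mat Ah *v x - b_vec Ah bh))\<^sup>2 > \<rho>)"
proof (intro conjI ballI)
  show "\<not> (\<exists>x \<in> feasible Ah bh. objective Fh ch x > \<rho>)"
    unfolding assms(8,5) by (auto simp: not_less finite_feasible)
next
  fix x assume x: "x \<in> infeasible Ah bh"
  let ?r = "A_mat Ah *v x - b_vec Ah bh"
  have "l \<le> objective Fh ch x"
    unfolding assms(4) using x by (simp add: finite_infeasible)
  \<comment> \<open>Multiplying by a factor of at least 1 does not decrease \<sigma>, since
    \<open>l < u\<close> and \<open>\<epsilon> > 0\<close> make \<sigma> positive.\<close>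
  moreover have "\<sigma> \<le> \<sigma> * (norm ?r)\<^sup>2"
  proof -
    have "1 \<le> norm ?r"
      using x by (intro norm_Ints_vector_ge_1 residual_component_in_Ints) (auto simp: infeasible_def)
    then show ?thesis
      using assms(6,7,9) by (simp add: one_le_power)
  qed
  \<comment> \<open>The strict inequality comes from \<epsilon>: the two lower bounds add up to
    \<open>l + \<sigma> = u + \<epsilon>\<close>.\<close>
  ultimately show "objective Fh ch x + \<sigma> * (norm ?r)\<^sup>2 > \<rho>"
    using assms(7,8,9) by linarith
qed

end
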